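(* For any monoids $K$ and $Q$, the conglomerate $\mathrm{Ext}_{\mathcal{S}}^1(Q,K)$ of equivalence classes of Schreier extensions of monoids from $K$ to $Q$ is small, i.e., it admits a bijection to a set.
   Context: Foundations: one works in ZFC with a fixed Grothendieck universe $\mathcal{U}$ (containing $\mathbb{N}$). The objects satisfying the ZFC axioms (including the Axiom of Choice) are called conglomerates; the elements of $\mathcal{U}$ are called sets, and the subconglomerates of $\mathcal{U}$ are called classes. A conglomerate is small when it admits a bijection to a set (an element of $\mathcal{U}$). Monoids have sets as underlying sets. Monoids are written additively (but are not assumed commutative). A Schreier extension of monoids from $K$ to $Q$ is a pair $(k,q)$ of monoid morphisms $K\xrightarrow{k}X\xrightarrow{q}Q$ where $q$ is a surjection and $k$ is a kernel of $q$, such that for each $v\in Q$ there exists an $x_v\in q^{-1}(v)$ such that for each $x\in q^{-1}(v)$ there is a unique $u\in K$ satisfying $x=k(u)+x_v$. (Then $q$ is a cokernel of $k$, so a Schreier extension is a short exact sequence of monoids.) Consider the category whose objects are the Schreier extensions from $K$ to $Q$, and whose morphisms $(k\colon K\to X,\,q\colon X\to Q)\to(k'\colon K\to X',\,q'\colon X'\to Q)$ are the monoid morphisms $\xi\colon X\to X'$ with $\xi k=k'$ and $q'\xi=q$. Then $\mathrm{Ext}_{\mathcal{S}}^1(Q,K)$ is the conglomerate of connected components of this category (two objects being in the same component if and only if they are joined by a finite zigzag of morphisms). *)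

theory Defs
  imports "HOL-Algebra.Group"
begin

text \<open>
  The elements of the type \<open>'u\<close> are the elements of a Grothendieck universe; \<open>elts x\<close> is
  the collection of the members of \<open>x\<close>. Conglomerates are HOL sets over types built from
  \<open>'u\<close>, and classes are terms of type \<open>'u set\<close>. Transitivity of the universe is built into the
  type of \<open>elts\<close>; extensionality and foundation are inherited from the surrounding ZFC.
  In \<open>powerset\<close> and \<open>union\<close>, subsets and families are arbitrary HOL sets and functions,
  that is, arbitrary conglomerates, as in the definition of a Grothendieck universe.
\<close>

locale grothendieck_universe =
  fixes elts :: "'u \<Rightarrow> 'u set"
  assumes extensionality: "elts x = elts y \<Longrightarrow> x = y"
    and foundation: "wf {(x, y). x \<in> elts y}"
    and pairing: "\<exists>p. elts p = {x, y}"
    and powerset: "\<exists>p. elts ` elts p = Pow (elts x)"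
    and union: "\<exists>w. elts w = (\<Union>i\<in>elts I. elts (f i))"
    and naturals: "\<exists>num \<omega>. elts (num (0::nat)) = {} \<and>
        (\<forall>n. elts (num (Suc n)) = insert (num n) (elts (num n))) \<and> elts \<omega> = range num"

definition small :: "('u \<Rightarrow> 'u set) \<Rightarrow> 'a set \<Rightarrow> bool" where
  "small elts C \<longleftrightarrow> (\<exists>s f. bij_betw f C (elts s))"

text \<open>
  Monoids whose underlying set is an element of the universe, in the multiplicative notation of
  \<open>HOL-Algebra\<close>. Operations and morphisms are normalised to \<open>undefined\<close> outside the
  carriers, so that equality in HOL is equality of monoids and of functions between them.
\<close>

definition Mon :: "('u \<Rightarrow> 'u set) \<Rightarrow> 'u monoid set" where
  "Mon elts = {M. monoid M \<and> (\<exists>s. carrier M = elts s) \<and>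
     (\<forall>x y. x \<notin> carrier M \<or> y \<notin> carrier M \<longrightarrow> x \<otimes>\<^bsub>M\<^esub> y = undefined)}"

text \<open>The library's \<^const>\<open>hom\<close> does not require preservation of the unit.\<close>

definition monoid_hom :: "'u monoid \<Rightarrow> 'u monoid \<Rightarrow> ('u \<Rightarrow> 'u) set" where
  "monoid_hom M N = {h \<in> hom M N \<inter> extensional (carrier M). h \<one>\<^bsub>M\<^esub> = \<one>\<^bsub>N\<^esub>}"

definition is_kernel ::
    "('u \<Rightarrow> 'u set) \<Rightarrow> 'u monoid \<Rightarrow> 'u monoid \<Rightarrow> 'u monoid \<Rightarrow> ('u \<Rightarrow> 'u) \<Rightarrow> ('u \<Rightarrow> 'u) \<Rightarrow> bool" where
  "is_kernel elts K X Q k q \<longleftrightarrow>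
     k \<in> monoid_hom K X \<and> (\<forall>u\<in>carrier K. q (k u) = \<one>\<^bsub>Q\<^esub>) \<and>
     (\<forall>Z\<in>Mon elts. \<forall>h\<in>monoid_hom Z X. (\<forall>z\<in>carrier Z. q (h z) = \<one>\<^bsub>Q\<^esub>) \<longrightarrow>
        (\<exists>!g. g \<in> monoid_hom Z K \<and> (\<forall>z\<in>carrier Z. k (g z) = h z)))"

type_synonym 'u extension = "'u monoid \<times> ('u \<Rightarrow> 'u) \<times> ('u \<Rightarrow> 'u)"

definition schreier_extensions ::
    "('u \<Rightarrow> 'u set) \<Rightarrow> 'u monoid \<Rightarrow> 'u monoid \<Rightarrow> 'u extension set" where
  "schreier_extensions elts Q K = {(X, k, q).
     X \<in> Mon elts \<and> k \<in> monoid_hom K X \<and> q \<in> monoid_hom X Q \<and>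
     q ` carrier X = carrier Q \<and> is_kernel elts K X Q k q \<and>
     (\<forall>v\<in>carrier Q. \<exists>xv\<in>carrier X. q xv = v \<and>
        (\<forall>x\<in>carrier X. q x = v \<longrightarrow> (\<exists>!u. u \<in> carrier K \<and> x = k u \<otimes>\<^bsub>X\<^esub> xv)))}"

definition extension_morphisms ::
    "'u monoid \<Rightarrow> 'u extension \<Rightarrow> 'u extension \<Rightarrow> ('u \<Rightarrow> 'u) set" where
  "extension_morphisms K = (\<lambda>(X, k, q) (X', k', q'). {\<xi> \<in> monoid_hom X X'.
     (\<forall>u\<in>carrier K. \<xi> (k u) = k' u) \<and> (\<forall>x\<in>carrier X. q' (\<xi> x) = q x)})"

definition extension_joined ::
    "('u \<Rightarrow> 'u set) \<Rightarrow> 'u monoid \<Rightarrow> 'u monoid \<Rightarrow> 'u extension \<Rightarrow> 'u extension \<Rightarrow> bool" where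
  "extension_joined elts Q K E E' \<longleftrightarrow>
     E \<in> schreier_extensions elts Q K \<and> E' \<in> schreier_extensions elts Q K \<and>
     extension_morphisms K E E' \<noteq> {}"

text \<open>Connected components: \<^const>\<open>equivclp\<close> is the relation of being joined by a finite zigzag.\<close>

definition Ext1_S ::
    "('u \<Rightarrow> 'u set) \<Rightarrow> 'u monoid \<Rightarrow> 'u monoid \<Rightarrow> 'u extension set set" where
  "Ext1_S elts Q K =
     schreier_extensions elts Q K // {(E, E'). equivclp (extension_joined elts Q K) E E'}"

end

theory Submission
  imports Defs
begin

text \<open>
  Let \<open>(X, k, q)\<close> be a Schreier extension and choose for each \<open>v\<close> in \<open>Q\<close> a representative
  \<open>x\<^sub>v\<close> as in the Schreier condition. Then \<open>(u, v) \<mapsto> k u + x\<^sub>v\<close> is a bijection from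
  \<open>K \<times> Q\<close> onto \<open>X\<close> under which \<open>q\<close> becomes the second projection
  (\<open>schreier_coordinates\<close>). In these coordinates the extension is described completely by two
  relations: the graph of its addition, a subset of \<open>(K \<times> Q) \<times> (K \<times> Q) \<times> (K \<times> Q)\<close>, and the
  graph of \<open>k\<close>, a subset of \<open>K \<times> (K \<times> Q)\<close>. Two extensions with the same two graphs are
  isomorphic, by the map that identifies points with the same coordinates
  (\<open>same_graphs_joined\<close>).

  So equivalence classes inject into the product of the power sets of these two products. Both
  \<open>K\<close> and \<open>Q\<close> are elements of the universe, and smallness passes to products, power sets and
  anything that injects into a small conglomerate, so there is only a set of equivalence classes.
  All choices are made outside the universe: neither the extensions nor the coordinates have to
  form a set, only the possible values of the graphs do.
\<close>

section \<open>Closure properties of smallness\<close>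

context grothendieck_universe
begin

lemma small_elts: "small elts (elts s)"
  unfolding small_def using bij_betw_id by blast

lemma subset_of_elts:
  assumes "S \<subseteq> elts s"
  obtains t where "elts t = S"
  using powerset[of s] assms by (metis Pow_iff imageE)

lemma small_if_inj_on:
  assumes "small elts D" "inj_on f C" "f ` C \<subseteq> D"
  shows "small elts C"
proof -
  obtain s g where g: "bij_betw g D (elts s)"
    using assms(1) unfolding small_def by blast
  have "(g \<circ> f) ` C \<subseteq> elts s"
    using g assms(3) by (auto simp: bij_betw_def)
  then obtain t where t: "elts t = (g \<circ> f) ` C"
    by (rule subset_of_elts)
  have "inj_on (g \<circ> f) C"
    using assms(2,3) g by (meson bij_betw_def comp_inj_on inj_on_subset)
  then have "bij_betw (g \<circ> f) C (elts t)"
    by (simp add: bij_betw_def t)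
  then show ?thesis
    unfolding small_def by blast
qed

text \<open>
  An invariant with values in a small conglomerate bounds any image on which it is complete: a
  point of the image is recovered from the invariant of one chosen preimage.
\<close>

lemma small_image_if_invariant:
  assumes "small elts D" "F ` S \<subseteq> D"
    and "\<And>x y. \<lbrakk>x \<in> S; y \<in> S; F x = F y\<rbrakk> \<Longrightarrow> g x = g y"
  shows "small elts (g ` S)"
proof (rule small_if_inj_on[OF assms(1)])
  show "inj_on (F \<circ> inv_into S g) (g ` S)"
    using assms(3) by (intro inj_onI) (metis comp_apply f_inv_into_f inv_into_into)
  show "(F \<circ> inv_into S g) ` g ` S \<subseteq> D"
    by (auto intro!: subsetD[OF assms(2)] imageI inv_into_into)
qed

lemma small_Pow:
  assumes "small elts A"
  shows "small elts (Pow A)"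
proof -
  obtain s f where f: "bij_betw f A (elts s)"
    using assms unfolding small_def by blast
  obtain p where p: "elts ` elts p = Pow (elts s)"
    using powerset by blast
  have "bij_betw elts (elts p) (Pow (elts s))"
    unfolding bij_betw_def using p by (intro conjI inj_onI extensionality)
  then have "bij_betw (inv_into (elts p) elts) (Pow (elts s)) (elts p)"
    by (rule bij_betw_inv_into)
  then have "bij_betw (inv_into (elts p) elts \<circ> image f) (Pow A) (elts p)"
    using bij_betw_Pow[OF f] by (rule bij_betw_trans[rotated])
  then show ?thesis
    unfolding small_def by blast
qed

text \<open>Replacement is the union axiom for a family of singletons.\<close>

lemma replacement: "\<exists>w. elts w = f ` elts s"
proof -
  obtain sing where sing: "\<And>x. elts (sing x) = {x}"
  proof -
    have "\<exists>p. elts p = {x}" for x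
      using pairing[of x x] by simp
    then show ?thesis
      using that by metis
  qed
  obtain w where "elts w = (\<Union>i\<in>elts s. elts (sing (f i)))"
    using union[where I = s and f = "\<lambda>i. sing (f i)"] by auto
  then show ?thesis
    by (intro exI[of _ w]) (auto simp: sing)
qed

text \<open>Kuratowski pairs, which the pairing axiom provides inside the universe.\<close>

lemma ordered_pairs: "\<exists>pr :: 'u \<Rightarrow> 'u \<Rightarrow> 'u. \<forall>a b c d. pr a b = pr c d \<longrightarrow> a = c \<and> b = d"
proof -
  obtain up where up: "\<And>x y. elts (up x y) = {x, y}"
    using pairing by metis
  have up_eq: "up a b = up c d \<longleftrightarrow> {a, b} = {c, d}" for a b c d
    using up extensionality by metis
  have "a = c \<and> b = d" if "up (up a a) (up a b) = up (up c c) (up c d)" for a b c d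
    using that by (auto simp: up_eq doubleton_eq_iff)
  then show ?thesis
    by (intro exI[of _ "\<lambda>a b. up (up a a) (up a b)"]) blast
qed

text \<open>
  Replacement makes every row \<open>{x} \<times> B\<close> of the product a set, and the union axiom collects the rows.
\<close>

lemma small_Times:
  assumes "small elts A" "small elts B"
  shows "small elts (A \<times> B)"
proof -
  obtain s f t g where f: "bij_betw f A (elts s)" and g: "bij_betw g B (elts t)"
    using assms unfolding small_def by blast
  obtain pr :: "'u \<Rightarrow> 'u \<Rightarrow> 'u" where pr: "\<And>a b c d. pr a b = pr c d \<Longrightarrow> a = c \<and> b = d"
    using ordered_pairs by blast
  obtain row where row: "\<And>x. elts (row x) = pr x ` elts t"
    using replacement[of "pr _" t] by metis
  obtain w where w: "elts w = (\<Union>x\<in>elts s. elts (row x))"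
    using union by blast
  show ?thesis
  proof (rule small_if_inj_on[OF small_elts[of w]])
    show "inj_on (\<lambda>(a, b). pr (f a) (g b)) (A \<times> B)"
    proof (rule inj_onI, clarify)
      fix a b a' b'
      assume "a \<in> A" "b \<in> B" "a' \<in> A" "b' \<in> B" "pr (f a) (g b) = pr (f a') (g b')"
      then show "a = a' \<and> b = b'"
        using pr f g by (metis bij_betw_def inj_onD)
    qed
    show "(\<lambda>(a, b). pr (f a) (g b)) ` (A \<times> B) \<subseteq> elts w"
      using f g by (auto simp: w row dest: bij_betw_apply)
  qed
qed

end

section \<open>Coordinates on a Schreier extension\<close>

definition coordinates ::
    "'u monoid \<Rightarrow> 'u monoid \<Rightarrow> 'u extension \<Rightarrow> ('u \<times> 'u \<Rightarrow> 'u) \<Rightarrow> bool" where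
  "coordinates Q K = (\<lambda>(X, k, q) b.
     bij_betw b (carrier K \<times> carrier Q) (carrier X) \<and>
     (\<forall>u\<in>carrier K. \<forall>v\<in>carrier Q. q (b (u, v)) = v))"

text \<open>
  The fibres of \<open>q\<close> partition \<open>X\<close>, and the Schreier condition says that translating \<open>k\<close> by the
  representative of a fibre is a bijection from \<open>K\<close> onto that fibre. Translates of \<open>k\<close> stay in the
  fibre because \<open>q k\<close> is trivial.
\<close>

lemma schreier_coordinates:
  assumes "Q \<in> Mon elts" "E \<in> schreier_extensions elts Q K"
  shows "\<exists>b. coordinates Q K E b"
proof -
  obtain X k q where E: "E = (X, k, q)"
    by (cases E)
  have ext: "X \<in> Mon elts" "k \<in> monoid_hom K X" "q \<in> monoid_hom X Q" "is_kernel elts K X Q k q"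
    and schreier: "\<forall>v\<in>carrier Q. \<exists>xv\<in>carrier X. q xv = v \<and>
        (\<forall>x\<in>carrier X. q x = v \<longrightarrow> (\<exists>!u. u \<in> carrier K \<and> x = k u \<otimes>\<^bsub>X\<^esub> xv))"
    using assms(2) unfolding E schreier_extensions_def mem_Collect_eq prod.case by blast+
  have X: "monoid X" and Q: "monoid Q"
    using ext(1) assms(1) by (auto simp: Mon_def)
  have k: "k \<in> carrier K \<rightarrow> carrier X" and q: "q \<in> hom X Q"
    using ext(2,3) by (auto simp: monoid_hom_def hom_def)
  have qk: "\<And>u. u \<in> carrier K \<Longrightarrow> q (k u) = \<one>\<^bsub>Q\<^esub>"
    using ext(4) by (simp add: is_kernel_def)
  interpret X: monoid X by (rule X)
  interpret Q: monoid Q by (rule Q)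
  obtain r where r: "\<And>v. v \<in> carrier Q \<Longrightarrow> r v \<in> carrier X"
      "\<And>v. v \<in> carrier Q \<Longrightarrow> q (r v) = v"
    and ex1: "\<And>v x. \<lbrakk>v \<in> carrier Q; x \<in> carrier X; q x = v\<rbrakk>
        \<Longrightarrow> \<exists>!u. u \<in> carrier K \<and> x = k u \<otimes>\<^bsub>X\<^esub> r v"
  proof -
    obtain r where "\<forall>v\<in>carrier Q. r v \<in> carrier X \<and> q (r v) = v \<and>
        (\<forall>x\<in>carrier X. q x = v \<longrightarrow> (\<exists>!u. u \<in> carrier K \<and> x = k u \<otimes>\<^bsub>X\<^esub> r v))"
      using bchoice[OF schreier[unfolded Bex_def]] by blast
    then show ?thesis
      by (intro that[of r]) simp_all
  qed
  define b where "b = (\<lambda>(u, v). k u \<otimes>\<^bsub>X\<^esub> r v)"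
  have b_closed: "b (u, v) \<in> carrier X" if "u \<in> carrier K" "v \<in> carrier Q" for u v
    using that k r by (auto simp: b_def)
  have qb: "q (b (u, v)) = v" if "u \<in> carrier K" "v \<in> carrier Q" for u v
    using that k r qk hom_mult[OF q, of "k u" "r v"] by (auto simp: b_def)
  have "inj_on b (carrier K \<times> carrier Q)"
  proof (rule inj_onI, clarify)
    fix u v u' v'
    assume uv: "u \<in> carrier K" "v \<in> carrier Q" "u' \<in> carrier K" "v' \<in> carrier Q"
      and eq: "b (u, v) = b (u', v')"
    have "v = v'"
      using qb[OF uv(1,2)] qb[OF uv(3,4)] eq by simp
    moreover have "u = u'"
    proof -
      have "b (u, v) = k u \<otimes>\<^bsub>X\<^esub> r v" "b (u, v) = k u' \<otimes>\<^bsub>X\<^esub> r v"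
        using eq \<open>v = v'\<close> by (simp_all add: b_def)
      then show ?thesis
        using ex1[OF uv(2) b_closed[OF uv(1,2)] qb[OF uv(1,2)]] uv(1,3) by blast
    qed
    ultimately show "u = u' \<and> v = v'"
      by simp
  qed
  moreover have "b ` (carrier K \<times> carrier Q) = carrier X"
  proof (intro equalityI subsetI)
    fix x assume x: "x \<in> carrier X"
    then have "q x \<in> carrier Q"
      using q by (auto simp: hom_def)
    then obtain u where "u \<in> carrier K" "x = k u \<otimes>\<^bsub>X\<^esub> r (q x)"
      using ex1 x by blast
    then show "x \<in> b ` (carrier K \<times> carrier Q)"
      using \<open>q x \<in> carrier Q\<close> by (intro image_eqI[of _ _ "(u, q x)"]) (auto simp: b_def)
  qed (use b_closed in auto)
  ultimately show ?thesis
    using qb unfolding coordinates_def E bij_betw_def by auto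
qed

definition structure_graphs ::
    "'u monoid \<Rightarrow> 'u monoid \<Rightarrow> 'u extension \<Rightarrow> ('u \<times> 'u \<Rightarrow> 'u) \<Rightarrow>
      (('u \<times> 'u) \<times> ('u \<times> 'u) \<times> ('u \<times> 'u)) set \<times> ('u \<times> 'u \<times> 'u) set" where
  "structure_graphs Q K = (\<lambda>(X, k, q) b. let P = carrier K \<times> carrier Q in
     ({(x, y, z) \<in> P \<times> P \<times> P. b x \<otimes>\<^bsub>X\<^esub> b y = b z}, {(u, x) \<in> carrier K \<times> P. k u = b x}))"

text \<open>
  The map \<open>b x \<mapsto> b' x\<close> preserves addition and is compatible with \<open>k\<close> because the graphs agree, and
  compatible with \<open>q\<close> because \<open>q\<close> is a projection in any coordinates. The graphs do not mention
  the unit, but a homomorphism that is onto sends it to a left unit, hence to the unit.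
\<close>

lemma same_graphs_joined:
  assumes E: "E \<in> schreier_extensions elts Q K" "coordinates Q K E b"
    and E': "E' \<in> schreier_extensions elts Q K" "coordinates Q K E' b'"
    and graphs: "structure_graphs Q K E b = structure_graphs Q K E' b'"
  shows "extension_joined elts Q K E E'"
proof -
  obtain X k q X' k' q' where Eeq: "E = (X, k, q)" "E' = (X', k', q')"
    by (metis prod_cases3)
  define P where "P = carrier K \<times> carrier Q"
  have "X \<in> Mon elts" "X' \<in> Mon elts" "k \<in> monoid_hom K X"
    using E(1) E'(1) unfolding Eeq schreier_extensions_def mem_Collect_eq prod.case by blast+
  then have X: "monoid X" and X': "monoid X'" and k: "k \<in> carrier K \<rightarrow> carrier X"
    by (auto simp: Mon_def monoid_hom_def hom_def)
  interpret X: monoid X by (rule X)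
  interpret X': monoid X' by (rule X')
  have b: "bij_betw b P (carrier X)" and b': "bij_betw b' P (carrier X')"
    and qb: "\<And>x. x \<in> P \<Longrightarrow> q (b x) = q' (b' x)"
    using E(2) E'(2) unfolding Eeq coordinates_def P_def by auto
  have mult: "b' x \<otimes>\<^bsub>X'\<^esub> b' y = b' z"
    if "x \<in> P" "y \<in> P" "z \<in> P" "b x \<otimes>\<^bsub>X\<^esub> b y = b z" for x y z
  proof -
    have "(x, y, z) \<in> fst (structure_graphs Q K E b)"
      using that by (simp add: structure_graphs_def Eeq Let_def P_def)
    then show ?thesis
      unfolding graphs by (simp add: structure_graphs_def Eeq Let_def)
  qed
  have kb: "k' u = b' x" if "u \<in> carrier K" "x \<in> P" "k u = b x" for u x
  proof -
    have "(u, x) \<in> snd (structure_graphs Q K E b)"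
      using that by (simp add: structure_graphs_def Eeq Let_def P_def)
    then show ?thesis
      unfolding graphs by (simp add: structure_graphs_def Eeq Let_def)
  qed
  define \<xi> where "\<xi> = restrict (b' \<circ> inv_into P b) (carrier X)"
  have onto: "\<exists>p\<in>P. x = b p" if "x \<in> carrier X" for x
    using that b by (auto simp: bij_betw_def)
  have onto': "\<exists>p\<in>P. x = b' p" if "x \<in> carrier X'" for x
    using that b' by (auto simp: bij_betw_def)
  have bX: "b p \<in> carrier X" "b' p \<in> carrier X'" if "p \<in> P" for p
    using that b b' by (auto simp: bij_betw_def)
  have \<xi>b: "\<xi> (b p) = b' p" if "p \<in> P" for p
    using that b bX by (simp add: \<xi>_def bij_betw_inv_into_left)
  have hom: "\<xi> \<in> hom X X'"
  proof (rule homI)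
    show "\<xi> x \<in> carrier X'" if "x \<in> carrier X" for x
      using onto[OF that] \<xi>b bX by auto
    show "\<xi> (x \<otimes>\<^bsub>X\<^esub> y) = \<xi> x \<otimes>\<^bsub>X'\<^esub> \<xi> y" if xy: "x \<in> carrier X" "y \<in> carrier X" for x y
    proof -
      obtain p p' p'' where "p \<in> P" "p' \<in> P" "p'' \<in> P" "x = b p" "y = b p'" "x \<otimes>\<^bsub>X\<^esub> y = b p''"
        using onto xy X.m_closed by metis
      then show ?thesis
        using mult[of p p' p''] \<xi>b by simp
    qed
  qed
  have left_unit: "\<xi> \<one>\<^bsub>X\<^esub> \<otimes>\<^bsub>X'\<^esub> x = x" if x: "x \<in> carrier X'" for x
  proof -
    obtain p where "p \<in> P" "x = b' p"
      using onto' x by blast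
    then show ?thesis
      using hom_mult[OF hom, of "\<one>\<^bsub>X\<^esub>" "b p"] \<xi>b bX by simp
  qed
  have one: "\<xi> \<one>\<^bsub>X\<^esub> = \<one>\<^bsub>X'\<^esub>"
    using left_unit[of "\<one>\<^bsub>X'\<^esub>"] hom_in_carrier[OF hom X.one_closed] by simp
  have "\<xi> (k u) = k' u" if u: "u \<in> carrier K" for u
  proof -
    obtain p where "p \<in> P" "k u = b p"
      using onto k u by (metis PiE)
    then show ?thesis
      using kb[OF u] \<xi>b by simp
  qed
  moreover have "q' (\<xi> x) = q x" if "x \<in> carrier X" for x
    using onto[OF that] \<xi>b qb by auto
  moreover have "\<xi> \<in> monoid_hom X X'"
    using hom one by (simp add: monoid_hom_def \<xi>_def)
  ultimately have "\<xi> \<in> extension_morphisms K E E'"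
    by (simp add: extension_morphisms_def Eeq)
  then show ?thesis
    using E(1) E'(1) unfolding extension_joined_def by blast
qed

section \<open>Smallness of the conglomerate of extension classes\<close>

theorem theorem7p2:
  fixes elts :: "'u \<Rightarrow> 'u set" and K Q :: "'u monoid"
  assumes "grothendieck_universe elts"
    and "K \<in> Mon elts" and "Q \<in> Mon elts"
  shows "small elts (Ext1_S elts Q K)"
proof -
  interpret grothendieck_universe elts by (rule assms(1))
  let ?S = "schreier_extensions elts Q K"
  let ?r = "{(E, E'). equivclp (extension_joined elts Q K) E E'}"
  let ?P = "carrier K \<times> carrier Q"
  let ?D = "Pow (?P \<times> ?P \<times> ?P) \<times> Pow (carrier K \<times> ?P)"
  define F where "F = (\<lambda>E. structure_graphs Q K E (SOME b. coordinates Q K E b))"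
  have coords: "coordinates Q K E (SOME b. coordinates Q K E b)" if "E \<in> ?S" for E
    using schreier_coordinates[OF assms(3) that] by (rule someI_ex)
  have "small elts (carrier K)" "small elts (carrier Q)"
    using assms(2,3) small_elts unfolding Mon_def by auto
  then have "small elts ?D"
    by (intro small_Times small_Pow)
  moreover have "F ` ?S \<subseteq> ?D"
    by (auto simp: F_def structure_graphs_def Let_def split: prod.splits)
  moreover have "?r `` {E} = ?r `` {E'}" if "E \<in> ?S" "E' \<in> ?S" "F E = F E'" for E E'
  proof -
    have "extension_joined elts Q K E E'"
      using same_graphs_joined[OF that(1) coords[OF that(1)] that(2) coords[OF that(2)]] that(3)
      by (simp add: F_def)
    then have "equivclp (extension_joined elts Q K) E E'"
      by (rule r_into_equivclp)
    then show ?thesis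
      by (blast intro: equivclp_trans equivclp_sym)
  qed
  ultimately have "small elts ((\<lambda>E. ?r `` {E}) ` ?S)"
    by (rule small_image_if_invariant)
  moreover have "Ext1_S elts Q K = (\<lambda>E. ?r `` {E}) ` ?S"
    by (auto simp: Ext1_S_def quotient_def)
  ultimately show ?thesis
    by simp
qed

end
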